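(* Let $(T,\mu,\eta)$ be a monad on $\mathsf{C}$ such that: $\mathcal{K}l(T)$ is $\omega$-cpo enriched; every hom-set of $\mathcal{K}l(T)$ has finite joins; and for every $\alpha:X\rightsquigarrow X$, every $f:X\to Y$ in $\mathsf{C}$ and every $\beta:Y\rightsquigarrow Y$, $f^\sharp\cdot\alpha\le\beta\cdot f^\sharp$ implies $f^\sharp\cdot(\alpha\vee 1_X)\le(\beta\vee 1_Y)\cdot f^\sharp$, and $f^\sharp\cdot\alpha\ge\beta\cdot f^\sharp$ implies $f^\sharp\cdot(\alpha\vee 1_X)\ge(\beta\vee 1_Y)\cdot f^\sharp$. Then $T$ is an ordered saturation monad, with $\alpha^*=\bigvee_{n\in\mathbb{N}}(1_X\vee\alpha)^n$ for every $\alpha:X\rightsquigarrow X$.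
   Context: Kleisli category $\mathcal{K}l(T)$: morphisms $X\rightsquigarrow Y$ are morphisms $X\to TY$, composition $g\cdot f=\mu_Z\circ Tg\circ f$, identity $1_X=\eta_X$; $f^\sharp=\eta_Y\circ f$; powers $\alpha^n$ are taken w.r.t. $\cdot$. A category is $\omega$-cpo enriched if each hom-set is a poset (composition monotone) in which every ascending chain $f_1\le f_2\le\cdots$ has a supremum, and composition preserves these suprema. Ordered saturation monad: $\mathcal{K}l(T)$ order enriched and for each $\alpha:X\rightsquigarrow X$ there is $\alpha^*$ with (1) $1\le\alpha^*$; (2) $\alpha\le\alpha^*$; (3) $\alpha^*\cdot\alpha^*\le\alpha^*$; (4) $\alpha^*\le\beta$ whenever $1\le\beta$, $\alpha\le\beta$, $\beta\cdot\beta\le\beta$; (5) for $f:X\to Y$ in $\mathsf{C}$ and $\beta:Y\rightsquigarrow Y$, $f^\sharp\cdot\alpha\le\beta\cdot f^\sharp\Rightarrow f^\sharp\cdot\alpha^*\le\beta^*\cdot f^\sharp$, and likewise with $\ge$. *)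

theory Defs
  imports "HOL-Algebra.Lattice"
begin

text \<open>Hom-sets are not required to be disjoint, so composition and the arrow part of a functor
  are indexed by objects. This lets the Kleisli category, whose arrows \<open>X \<leadsto> Y\<close> are
  literally the arrows \<open>X \<rightarrow> T Y\<close>, be a category over the same type of arrows.\<close>

record ('o, 'm) category =
  Obj :: "'o set"
  Hom :: "'o \<Rightarrow> 'o \<Rightarrow> 'm set"
  Comp :: "'o \<Rightarrow> 'o \<Rightarrow> 'o \<Rightarrow> 'm \<Rightarrow> 'm \<Rightarrow> 'm"
    \<comment> \<open>\<open>Comp C X Y Z g f\<close> is the composite of \<open>f\<close> from \<open>X\<close> to \<open>Y\<close> followed by \<open>g\<close> from \<open>Y\<close> to \<open>Z\<close>\<close>
  Id :: "'o \<Rightarrow> 'm"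

locale category =
  fixes C :: "('o, 'm) category"
  assumes Id_in_Hom: "X \<in> Obj C \<Longrightarrow> Id C X \<in> Hom C X X"
    and Comp_in_Hom:
      "\<lbrakk>X \<in> Obj C; Y \<in> Obj C; Z \<in> Obj C; f \<in> Hom C X Y; g \<in> Hom C Y Z\<rbrakk>
        \<Longrightarrow> Comp C X Y Z g f \<in> Hom C X Z"
    and Comp_Id_left:
      "\<lbrakk>X \<in> Obj C; Y \<in> Obj C; f \<in> Hom C X Y\<rbrakk> \<Longrightarrow> Comp C X Y Y (Id C Y) f = f"
    and Comp_Id_right:
      "\<lbrakk>X \<in> Obj C; Y \<in> Obj C; f \<in> Hom C X Y\<rbrakk> \<Longrightarrow> Comp C X X Y f (Id C X) = f"
    and Comp_assoc:
      "\<lbrakk>W \<in> Obj C; X \<in> Obj C; Y \<in> Obj C; Z \<in> Obj C;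
        f \<in> Hom C W X; g \<in> Hom C X Y; h \<in> Hom C Y Z\<rbrakk>
        \<Longrightarrow> Comp C W Y Z h (Comp C W X Y g f) = Comp C W X Z (Comp C X Y Z h g) f"

fun endo_power :: "('o, 'm) category \<Rightarrow> 'o \<Rightarrow> 'm \<Rightarrow> nat \<Rightarrow> 'm" where
  "endo_power C X \<alpha> 0 = Id C X"
| "endo_power C X \<alpha> (Suc n) = Comp C X X X \<alpha> (endo_power C X \<alpha> n)"

record ('o, 'm) endofunctor =
  ob :: "'o \<Rightarrow> 'o"
  arr :: "'o \<Rightarrow> 'o \<Rightarrow> 'm \<Rightarrow> 'm"

locale endofunctor = category C for C :: "('o, 'm) category" +
  fixes T :: "('o, 'm, 'z) endofunctor_scheme"
  assumes ob_in_Obj: "X \<in> Obj C \<Longrightarrow> ob T X \<in> Obj C"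
    and arr_in_Hom:
      "\<lbrakk>X \<in> Obj C; Y \<in> Obj C; f \<in> Hom C X Y\<rbrakk> \<Longrightarrow> arr T X Y f \<in> Hom C (ob T X) (ob T Y)"
    and arr_Id: "X \<in> Obj C \<Longrightarrow> arr T X X (Id C X) = Id C (ob T X)"
    and arr_Comp:
      "\<lbrakk>X \<in> Obj C; Y \<in> Obj C; Z \<in> Obj C; f \<in> Hom C X Y; g \<in> Hom C Y Z\<rbrakk>
        \<Longrightarrow> arr T X Z (Comp C X Y Z g f)
            = Comp C (ob T X) (ob T Y) (ob T Z) (arr T Y Z g) (arr T X Y f)"

record ('o, 'm) monad = "('o, 'm) endofunctor" +
  mult :: "'o \<Rightarrow> 'm"
  unit :: "'o \<Rightarrow> 'm"

locale monad = endofunctor C T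
  for C :: "('o, 'm) category" and T :: "('o, 'm) monad" +
  assumes unit_in_Hom: "X \<in> Obj C \<Longrightarrow> unit T X \<in> Hom C X (ob T X)"
    and unit_natural:
      "\<lbrakk>X \<in> Obj C; Y \<in> Obj C; f \<in> Hom C X Y\<rbrakk>
        \<Longrightarrow> Comp C X (ob T X) (ob T Y) (arr T X Y f) (unit T X)
            = Comp C X Y (ob T Y) (unit T Y) f"
    and mult_in_Hom: "X \<in> Obj C \<Longrightarrow> mult T X \<in> Hom C (ob T (ob T X)) (ob T X)"
    and mult_natural:
      "\<lbrakk>X \<in> Obj C; Y \<in> Obj C; f \<in> Hom C X Y\<rbrakk>
        \<Longrightarrow> Comp C (ob T (ob T X)) (ob T X) (ob T Y) (arr T X Y f) (mult T X)
            = Comp C (ob T (ob T X)) (ob T (ob T Y)) (ob T Y)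
                (mult T Y) (arr T (ob T X) (ob T Y) (arr T X Y f))"
    and mult_unit_left:
      "X \<in> Obj C \<Longrightarrow>
        Comp C (ob T X) (ob T (ob T X)) (ob T X) (mult T X) (unit T (ob T X)) = Id C (ob T X)"
    and mult_unit_right:
      "X \<in> Obj C \<Longrightarrow>
        Comp C (ob T X) (ob T (ob T X)) (ob T X) (mult T X) (arr T X (ob T X) (unit T X))
          = Id C (ob T X)"
    and mult_assoc:
      "X \<in> Obj C \<Longrightarrow>
        Comp C (ob T (ob T (ob T X))) (ob T (ob T X)) (ob T X)
            (mult T X) (arr T (ob T (ob T X)) (ob T X) (mult T X))
          = Comp C (ob T (ob T (ob T X))) (ob T (ob T X)) (ob T X)
              (mult T X) (mult T (ob T X))"

definition kleisli :: "('o, 'm) category \<Rightarrow> ('o, 'm) monad \<Rightarrow> ('o, 'm) category" where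
  "kleisli C T =
    \<lparr> Obj = Obj C,
      Hom = (\<lambda>X Y. Hom C X (ob T Y)),
      Comp = (\<lambda>X Y Z g f.
        Comp C X (ob T (ob T Z)) (ob T Z) (mult T Z)
          (Comp C X (ob T Y) (ob T (ob T Z)) (arr T Y (ob T Z) g) f)),
      Id = unit T \<rparr>"

definition sharp :: "('o, 'm) category \<Rightarrow> ('o, 'm) monad \<Rightarrow> 'o \<Rightarrow> 'o \<Rightarrow> 'm \<Rightarrow> 'm" where
  "sharp C T X Y f = Comp C X Y (ob T Y) (unit T Y) f"

text \<open>In the following, \<open>P X Y\<close> is the poset with carrier \<open>Hom K X Y\<close>.\<close>

locale order_enriched = category K for K :: "('o, 'm) category" +
  fixes P :: "'o \<Rightarrow> 'o \<Rightarrow> 'm gorder"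
  assumes carrier_hom: "\<lbrakk>X \<in> Obj K; Y \<in> Obj K\<rbrakk> \<Longrightarrow> carrier (P X Y) = Hom K X Y"
    and partial_order_hom: "\<lbrakk>X \<in> Obj K; Y \<in> Obj K\<rbrakk> \<Longrightarrow> partial_order (P X Y)"
    and Comp_mono:
      "\<lbrakk>X \<in> Obj K; Y \<in> Obj K; Z \<in> Obj K;
        f \<in> Hom K X Y; f' \<in> Hom K X Y; g \<in> Hom K Y Z; g' \<in> Hom K Y Z;
        f \<sqsubseteq>\<^bsub>P X Y\<^esub> f'; g \<sqsubseteq>\<^bsub>P Y Z\<^esub> g'\<rbrakk>
        \<Longrightarrow> Comp K X Y Z g f \<sqsubseteq>\<^bsub>P X Z\<^esub> Comp K X Y Z g' f'"

definition ascending_chain :: "'m gorder \<Rightarrow> (nat \<Rightarrow> 'm) \<Rightarrow> bool" where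
  "ascending_chain L f \<longleftrightarrow> (\<forall>n. f n \<in> carrier L \<and> f n \<sqsubseteq>\<^bsub>L\<^esub> f (Suc n))"

locale omega_cpo_enriched = order_enriched +
  assumes chain_sup_exists:
      "\<lbrakk>X \<in> Obj K; Y \<in> Obj K; ascending_chain (P X Y) f\<rbrakk>
        \<Longrightarrow> \<exists>s. is_lub (P X Y) s (range f)"
    and Comp_chain_sup_left:
      "\<lbrakk>X \<in> Obj K; Y \<in> Obj K; Z \<in> Obj K; ascending_chain (P X Y) f;
        is_lub (P X Y) s (range f); g \<in> Hom K Y Z\<rbrakk>
        \<Longrightarrow> is_lub (P X Z) (Comp K X Y Z g s) (range (\<lambda>n. Comp K X Y Z g (f n)))"
    and Comp_chain_sup_right:
      "\<lbrakk>W \<in> Obj K; X \<in> Obj K; Y \<in> Obj K; ascending_chain (P X Y) f;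
        is_lub (P X Y) s (range f); h \<in> Hom K W X\<rbrakk>
        \<Longrightarrow> is_lub (P W Y) (Comp K W X Y s h) (range (\<lambda>n. Comp K W X Y (f n) h))"

definition has_finite_joins :: "'m gorder \<Rightarrow> bool" where
  "has_finite_joins L \<longleftrightarrow>
    (\<forall>A. finite A \<and> A \<subseteq> carrier L \<longrightarrow> (\<exists>s. is_lub L s A))"

text \<open>The operator \<open>star X\<close> sends \<open>\<alpha>\<close> to \<open>\<alpha>\<^sup>*\<close>; it is uniquely determined on
  \<open>Hom (kleisli C T) X X\<close> by the first five assumptions on it.\<close>

locale ordered_saturation_monad =
  monad C T + order_enriched "kleisli C T" P
  for C :: "('o, 'm) category" and T :: "('o, 'm) monad" and P :: "'o \<Rightarrow> 'o \<Rightarrow> 'm gorder" +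
  fixes star :: "'o \<Rightarrow> 'm \<Rightarrow> 'm"
  assumes star_in_Hom:
      "\<lbrakk>X \<in> Obj C; \<alpha> \<in> Hom (kleisli C T) X X\<rbrakk> \<Longrightarrow> star X \<alpha> \<in> Hom (kleisli C T) X X"
    and Id_le_star:
      "\<lbrakk>X \<in> Obj C; \<alpha> \<in> Hom (kleisli C T) X X\<rbrakk>
        \<Longrightarrow> Id (kleisli C T) X \<sqsubseteq>\<^bsub>P X X\<^esub> star X \<alpha>"
    and le_star:
      "\<lbrakk>X \<in> Obj C; \<alpha> \<in> Hom (kleisli C T) X X\<rbrakk> \<Longrightarrow> \<alpha> \<sqsubseteq>\<^bsub>P X X\<^esub> star X \<alpha>"
    and star_star_le:
      "\<lbrakk>X \<in> Obj C; \<alpha> \<in> Hom (kleisli C T) X X\<rbrakk>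
        \<Longrightarrow> Comp (kleisli C T) X X X (star X \<alpha>) (star X \<alpha>) \<sqsubseteq>\<^bsub>P X X\<^esub> star X \<alpha>"
    and star_least:
      "\<lbrakk>X \<in> Obj C; \<alpha> \<in> Hom (kleisli C T) X X; \<beta> \<in> Hom (kleisli C T) X X;
        Id (kleisli C T) X \<sqsubseteq>\<^bsub>P X X\<^esub> \<beta>; \<alpha> \<sqsubseteq>\<^bsub>P X X\<^esub> \<beta>;
        Comp (kleisli C T) X X X \<beta> \<beta> \<sqsubseteq>\<^bsub>P X X\<^esub> \<beta>\<rbrakk>
        \<Longrightarrow> star X \<alpha> \<sqsubseteq>\<^bsub>P X X\<^esub> \<beta>"
    and star_lax:
      "\<lbrakk>X \<in> Obj C; Y \<in> Obj C; f \<in> Hom C X Y;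
        \<alpha> \<in> Hom (kleisli C T) X X; \<beta> \<in> Hom (kleisli C T) Y Y;
        Comp (kleisli C T) X X Y (sharp C T X Y f) \<alpha>
          \<sqsubseteq>\<^bsub>P X Y\<^esub> Comp (kleisli C T) X Y Y \<beta> (sharp C T X Y f)\<rbrakk>
        \<Longrightarrow> Comp (kleisli C T) X X Y (sharp C T X Y f) (star X \<alpha>)
          \<sqsubseteq>\<^bsub>P X Y\<^esub> Comp (kleisli C T) X Y Y (star Y \<beta>) (sharp C T X Y f)"
    and star_oplax:
      "\<lbrakk>X \<in> Obj C; Y \<in> Obj C; f \<in> Hom C X Y;
        \<alpha> \<in> Hom (kleisli C T) X X; \<beta> \<in> Hom (kleisli C T) Y Y;
        Comp (kleisli C T) X Y Y \<beta> (sharp C T X Y f)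
          \<sqsubseteq>\<^bsub>P X Y\<^esub> Comp (kleisli C T) X X Y (sharp C T X Y f) \<alpha>\<rbrakk>
        \<Longrightarrow> Comp (kleisli C T) X Y Y (star Y \<beta>) (sharp C T X Y f)
          \<sqsubseteq>\<^bsub>P X Y\<^esub> Comp (kleisli C T) X X Y (sharp C T X Y f) (star X \<alpha>)"

lemma (in monad) category_kleisli: "category (kleisli C T)"
proof
  fix X Y f assume a: "X \<in> Obj (kleisli C T)" "Y \<in> Obj (kleisli C T)" "f \<in> Hom (kleisli C T) X Y"
  show "Comp (kleisli C T) X Y Y (Id (kleisli C T) Y) f = f"
    using a by (simp add: kleisli_def ob_in_Obj arr_in_Hom unit_in_Hom mult_in_Hom
        Comp_assoc mult_unit_right Comp_Id_left)
  show "Comp (kleisli C T) X X Y f (Id (kleisli C T) X) = f"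
    using a by (simp add: kleisli_def ob_in_Obj arr_in_Hom unit_in_Hom mult_in_Hom
        unit_natural Comp_assoc mult_unit_left Comp_Id_left)
next
  fix W X Y Z f g h
  assume a: "W \<in> Obj (kleisli C T)" "X \<in> Obj (kleisli C T)" "Y \<in> Obj (kleisli C T)"
    "Z \<in> Obj (kleisli C T)" "f \<in> Hom (kleisli C T) W X" "g \<in> Hom (kleisli C T) X Y"
    "h \<in> Hom (kleisli C T) Y Z"
  note s = ob_in_Obj arr_in_Hom unit_in_Hom mult_in_Hom Comp_in_Hom
  show "Comp (kleisli C T) W Y Z h (Comp (kleisli C T) W X Y g f) =
        Comp (kleisli C T) W X Z (Comp (kleisli C T) X Y Z h g) f"
    using a by (simp add: kleisli_def s arr_Comp Comp_assoc mult_assoc)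
      (simp add: s Comp_assoc[symmetric] mult_natural)
qed (auto simp: kleisli_def ob_in_Obj arr_in_Hom unit_in_Hom mult_in_Hom intro!: Comp_in_Hom)

end

theory Submission
  imports Defs
begin

text \<open>Put \<open>e = 1 \<or> \<alpha>\<close>. Since \<open>1 \<le> e\<close>, the powers of \<open>e\<close> form an ascending chain, whose supremum
  \<open>s\<close> exists. Continuity of composition makes \<open>s \<cdot> s\<close> the supremum of the \<open>e\<^sup>n \<cdot> e\<^sup>m = e\<^sup>n\<^sup>+\<^sup>m\<close>, so
  \<open>s \<cdot> s \<le> s\<close>. An inequality between \<open>h \<cdot> \<alpha>\<close> and \<open>\<beta> \<cdot> h\<close>, with \<open>h = f\<^sup>\<sharp>\<close>, passes to \<open>1 \<or> \<alpha>\<close> and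
  \<open>1 \<or> \<beta>\<close> by hypothesis, then to their powers by induction, and to the suprema by continuity.\<close>

section \<open>Least upper bounds and binary joins\<close>

lemma is_lub_carrier: "is_lub L s A \<Longrightarrow> s \<in> carrier L"
  by (simp add: least_def Upper_def)

text \<open>\<open>Upper\<close> tests only the elements of \<open>A\<close> that lie in the
  carrier, so the inclusion of \<open>A\<close> in the carrier is what extends the bound to all of
  \<open>A\<close>.\<close>

lemma is_lub_upper: "\<lbrakk>is_lub L s A; A \<subseteq> carrier L; x \<in> A\<rbrakk> \<Longrightarrow> x \<sqsubseteq>\<^bsub>L\<^esub> s"
  by (auto simp: least_def Upper_def)

lemma is_lub_le:
  "\<lbrakk>is_lub L s A; u \<in> carrier L; \<And>x. x \<in> A \<Longrightarrow> x \<sqsubseteq>\<^bsub>L\<^esub> u\<rbrakk> \<Longrightarrow> s \<sqsubseteq>\<^bsub>L\<^esub> u"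
  by (auto simp: least_def Upper_def)

text \<open>A join is by definition the supremum of an unordered pair. This reconciles \<alpha>
  \<or> 1, as in the hypotheses on f, with 1 \<or> \<alpha>, as in the formula for the star.\<close>

lemma join_comm: "x \<squnion>\<^bsub>L\<^esub> y = y \<squnion>\<^bsub>L\<^esub> x"
  by (simp add: join_def insert_commute)

text \<open>The join is a value picked by \<open>SOME\<close>; it is a genuine supremum once one
  exists.\<close>

lemma has_finite_joins_is_lub_join:
  assumes "has_finite_joins L" "x \<in> carrier L" "y \<in> carrier L"
  shows "is_lub L (x \<squnion>\<^bsub>L\<^esub> y) {x, y}"
proof -
  have "\<exists>s. is_lub L s {x, y}"
    using assms by (simp add: has_finite_joins_def)
  then show ?thesis
    unfolding join_def sup_def by (rule someI_ex)
qed

section \<open>Powers of an endomorphism in an order enriched category\<close>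

context order_enriched
begin

lemma hom_le_refl: "\<lbrakk>X \<in> Obj K; Y \<in> Obj K; f \<in> Hom K X Y\<rbrakk> \<Longrightarrow> f \<sqsubseteq>\<^bsub>P X Y\<^esub> f"
  using partial_order_hom carrier_hom
  by (metis weak_partial_order.le_refl partial_order.axioms(1))

lemma hom_le_trans:
  "\<lbrakk>f \<sqsubseteq>\<^bsub>P X Y\<^esub> g; g \<sqsubseteq>\<^bsub>P X Y\<^esub> h; X \<in> Obj K; Y \<in> Obj K;
    f \<in> Hom K X Y; g \<in> Hom K X Y; h \<in> Hom K X Y\<rbrakk> \<Longrightarrow> f \<sqsubseteq>\<^bsub>P X Y\<^esub> h"
  using partial_order_hom carrier_hom
  by (metis weak_partial_order.le_trans partial_order.axioms(1))

lemma Comp_mono_left: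
  "\<lbrakk>X \<in> Obj K; Y \<in> Obj K; Z \<in> Obj K; f \<in> Hom K X Y; g \<in> Hom K Y Z; g' \<in> Hom K Y Z;
    g \<sqsubseteq>\<^bsub>P Y Z\<^esub> g'\<rbrakk> \<Longrightarrow> Comp K X Y Z g f \<sqsubseteq>\<^bsub>P X Z\<^esub> Comp K X Y Z g' f"
  by (simp add: Comp_mono hom_le_refl)

lemma Comp_mono_right:
  "\<lbrakk>X \<in> Obj K; Y \<in> Obj K; Z \<in> Obj K; f \<in> Hom K X Y; f' \<in> Hom K X Y; g \<in> Hom K Y Z;
    f \<sqsubseteq>\<^bsub>P X Y\<^esub> f'\<rbrakk> \<Longrightarrow> Comp K X Y Z g f \<sqsubseteq>\<^bsub>P X Z\<^esub> Comp K X Y Z g f'"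
  by (simp add: Comp_mono hom_le_refl)

lemma endo_power_in_Hom:
  "\<lbrakk>X \<in> Obj K; e \<in> Hom K X X\<rbrakk> \<Longrightarrow> endo_power K X e n \<in> Hom K X X"
  by (induction n) (simp_all add: Id_in_Hom Comp_in_Hom)

lemma endo_power_add:
  "\<lbrakk>X \<in> Obj K; e \<in> Hom K X X\<rbrakk>
    \<Longrightarrow> endo_power K X e (m + n) = Comp K X X X (endo_power K X e m) (endo_power K X e n)"
  by (induction m) (simp_all add: Comp_Id_left Comp_assoc endo_power_in_Hom)

text \<open>Multiply 1 \<le> e on the right by e^n: e^n = 1 . e^n \<le> e . e^n.\<close>

lemma endo_power_ascending_chain:
  assumes X: "X \<in> Obj K" and e: "e \<in> Hom K X X" and "Id K X \<sqsubseteq>\<^bsub>P X X\<^esub> e"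
  shows "ascending_chain (P X X) (endo_power K X e)"
  unfolding ascending_chain_def
proof (intro allI conjI)
  fix n
  show "endo_power K X e n \<in> carrier (P X X)"
    by (simp add: X carrier_hom e endo_power_in_Hom)
  have "Comp K X X X (Id K X) (endo_power K X e n) \<sqsubseteq>\<^bsub>P X X\<^esub> Comp K X X X e (endo_power K X e n)"
    using assms by (intro Comp_mono_left Id_in_Hom endo_power_in_Hom)
  then show "endo_power K X e n \<sqsubseteq>\<^bsub>P X X\<^esub> endo_power K X e (Suc n)"
    by (simp add: Comp_Id_left X e endo_power_in_Hom)
qed

text \<open>Inductively, e . e^n \<le> b . b \<le> b, starting from 1 \<le> b.\<close>

lemma endo_power_le:
  assumes X: "X \<in> Obj K" and e: "e \<in> Hom K X X" and b: "b \<in> Hom K X X"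
    and "Id K X \<sqsubseteq>\<^bsub>P X X\<^esub> b" and "e \<sqsubseteq>\<^bsub>P X X\<^esub> b" and bb: "Comp K X X X b b \<sqsubseteq>\<^bsub>P X X\<^esub> b"
  shows "endo_power K X e n \<sqsubseteq>\<^bsub>P X X\<^esub> b"
proof (induction n)
  case (Suc n)
  have "Comp K X X X e (endo_power K X e n) \<sqsubseteq>\<^bsub>P X X\<^esub> Comp K X X X b b"
    using assms Suc by (intro Comp_mono endo_power_in_Hom)
  from hom_le_trans[OF this bb] show ?case
    by (simp add: X b e Comp_in_Hom endo_power_in_Hom)
qed (simp add: assms)

text \<open>The induction step slides one factor past h at a time: h . a . a^n \<le> b . h . a^n
  \<le> b . b^n . h. Rewriting with \<open>Comp_assoc\<close> brings both middle terms to the same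
  form, so that transitivity applies.\<close>

lemma endo_power_lax:
  assumes X: "X \<in> Obj K" and Y: "Y \<in> Obj K" and h: "h \<in> Hom K X Y"
    and a: "a \<in> Hom K X X" and b: "b \<in> Hom K Y Y"
    and le: "Comp K X X Y h a \<sqsubseteq>\<^bsub>P X Y\<^esub> Comp K X Y Y b h"
  shows "Comp K X X Y h (endo_power K X a n) \<sqsubseteq>\<^bsub>P X Y\<^esub> Comp K X Y Y (endo_power K Y b n) h"
proof (induction n)
  case 0
  show ?case
    using X Y h by (simp add: Comp_Id_left Comp_Id_right hom_le_refl)
next
  case (Suc n)
  let ?a = "endo_power K X a n" and ?b = "endo_power K Y b n"
  note [simp] = X Y h a b endo_power_in_Hom Comp_in_Hom
  have "Comp K X X Y (Comp K X X Y h a) ?a \<sqsubseteq>\<^bsub>P X Y\<^esub> Comp K X X Y (Comp K X Y Y b h) ?a"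
    using le by (simp add: Comp_mono_left)
  moreover have "Comp K X Y Y b (Comp K X X Y h ?a) \<sqsubseteq>\<^bsub>P X Y\<^esub> Comp K X Y Y b (Comp K X Y Y ?b h)"
    using Suc by (simp add: Comp_mono_right)
  ultimately show ?case
    by (simp add: Comp_assoc) (erule (1) hom_le_trans; simp)
qed

text \<open>The same middle term is reached from the other side: b . b^n . h \<le> b . h . a^n \<le>
  h . a . a^n.\<close>

lemma endo_power_oplax:
  assumes X: "X \<in> Obj K" and Y: "Y \<in> Obj K" and h: "h \<in> Hom K X Y"
    and a: "a \<in> Hom K X X" and b: "b \<in> Hom K Y Y"
    and le: "Comp K X Y Y b h \<sqsubseteq>\<^bsub>P X Y\<^esub> Comp K X X Y h a"
  shows "Comp K X Y Y (endo_power K Y b n) h \<sqsubseteq>\<^bsub>P X Y\<^esub> Comp K X X Y h (endo_power K X a n)"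
proof (induction n)
  case 0
  show ?case
    using X Y h by (simp add: Comp_Id_left Comp_Id_right hom_le_refl)
next
  case (Suc n)
  let ?a = "endo_power K X a n" and ?b = "endo_power K Y b n"
  note [simp] = X Y h a b endo_power_in_Hom Comp_in_Hom
  have "Comp K X Y Y b (Comp K X Y Y ?b h) \<sqsubseteq>\<^bsub>P X Y\<^esub> Comp K X Y Y b (Comp K X X Y h ?a)"
    using Suc by (simp add: Comp_mono_right)
  moreover have "Comp K X X Y (Comp K X Y Y b h) ?a \<sqsubseteq>\<^bsub>P X Y\<^esub> Comp K X X Y (Comp K X X Y h a) ?a"
    using le by (simp add: Comp_mono_left)
  ultimately show ?case
    by (simp add: Comp_assoc) (erule (1) hom_le_trans; simp)
qed

lemma endo_power_le_lub:
  assumes "X \<in> Obj K" "e \<in> Hom K X X" "is_lub (P X X) s (range (endo_power K X e))"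
  shows "endo_power K X e n \<sqsubseteq>\<^bsub>P X X\<^esub> s"
  using assms by (intro is_lub_upper[of _ s]) (auto simp: carrier_hom endo_power_in_Hom)

lemma endo_power_lub_in_Hom:
  assumes "X \<in> Obj K" "is_lub (P X X) s (range (endo_power K X e))"
  shows "s \<in> Hom K X X"
  using is_lub_carrier[OF assms(2)] assms(1) by (simp add: carrier_hom)

end

section \<open>Suprema of powers\<close>

context omega_cpo_enriched
begin

lemma endo_power_lub_idem:
  assumes X: "X \<in> Obj K" and e: "e \<in> Hom K X X" and Id: "Id K X \<sqsubseteq>\<^bsub>P X X\<^esub> e"
    and s: "is_lub (P X X) s (range (endo_power K X e))"
  shows "Comp K X X X s s \<sqsubseteq>\<^bsub>P X X\<^esub> s"
proof -
  note chain = endo_power_ascending_chain[OF X e Id]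
  have sH: "s \<in> Hom K X X"
    using X s by (rule endo_power_lub_in_Hom)
  have sc: "s \<in> carrier (P X X)"
    using s by (rule is_lub_carrier)
  \<comment> \<open>With the left factor e^n fixed, this composite is the supremum over m of e^n .
    e^m = e^(n+m), and each of these powers is below s.\<close>
  have "Comp K X X X (endo_power K X e n) s \<sqsubseteq>\<^bsub>P X X\<^esub> s" for n
    using Comp_chain_sup_left[OF X X X chain s endo_power_in_Hom[OF X e, of n]] sc
    by (rule is_lub_le)
      (use endo_power_le_lub[OF X e s] in \<open>auto simp: endo_power_add[OF X e, symmetric]\<close>)
  \<comment> \<open>Now the left factor varies: s . s is the supremum over n of e^n . s.\<close>
  then show ?thesis
    using Comp_chain_sup_right[OF X X X chain s sH] sc
    by (auto intro: is_lub_le)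
qed

text \<open>Here h . s is the supremum of the h . a^n, and h . a^n \<le> b^n . h \<le> t . h. The
  condition 1 \<le> a makes the powers of a a chain, as continuity requires.\<close>

lemma endo_power_lub_lax:
  assumes X: "X \<in> Obj K" and Y: "Y \<in> Obj K" and h: "h \<in> Hom K X Y"
    and a: "a \<in> Hom K X X" "Id K X \<sqsubseteq>\<^bsub>P X X\<^esub> a" and b: "b \<in> Hom K Y Y"
    and s: "is_lub (P X X) s (range (endo_power K X a))"
    and t: "is_lub (P Y Y) t (range (endo_power K Y b))"
    and le: "Comp K X X Y h a \<sqsubseteq>\<^bsub>P X Y\<^esub> Comp K X Y Y b h"
  shows "Comp K X X Y h s \<sqsubseteq>\<^bsub>P X Y\<^esub> Comp K X Y Y t h"
proof -
  have tH: "t \<in> Hom K Y Y"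
    using Y t by (rule endo_power_lub_in_Hom)
  note [simp] = X Y h a b tH endo_power_in_Hom Comp_in_Hom
  have "Comp K X X Y h (endo_power K X a n) \<sqsubseteq>\<^bsub>P X Y\<^esub> Comp K X Y Y t h" for n
    using endo_power_lax[OF X Y h a(1) b le]
      Comp_mono_left[OF X Y Y h _ _ endo_power_le_lub[OF Y b t]]
    by (rule hom_le_trans) simp_all
  then show ?thesis
    using Comp_chain_sup_left[OF X X Y endo_power_ascending_chain[OF X a] s h]
    by (auto simp: carrier_hom intro: is_lub_le)
qed

text \<open>Now t . h is the supremum to be bounded, so the chain is that of the powers of b, with
  b^n . h \<le> h . a^n \<le> h . s.\<close>

lemma endo_power_lub_oplax:
  assumes X: "X \<in> Obj K" and Y: "Y \<in> Obj K" and h: "h \<in> Hom K X Y"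
    and a: "a \<in> Hom K X X" and b: "b \<in> Hom K Y Y" "Id K Y \<sqsubseteq>\<^bsub>P Y Y\<^esub> b"
    and s: "is_lub (P X X) s (range (endo_power K X a))"
    and t: "is_lub (P Y Y) t (range (endo_power K Y b))"
    and le: "Comp K X Y Y b h \<sqsubseteq>\<^bsub>P X Y\<^esub> Comp K X X Y h a"
  shows "Comp K X Y Y t h \<sqsubseteq>\<^bsub>P X Y\<^esub> Comp K X X Y h s"
proof -
  have sH: "s \<in> Hom K X X"
    using X s by (rule endo_power_lub_in_Hom)
  note [simp] = X Y h a b sH endo_power_in_Hom Comp_in_Hom
  have "Comp K X Y Y (endo_power K Y b n) h \<sqsubseteq>\<^bsub>P X Y\<^esub> Comp K X X Y h s" for n
    using endo_power_oplax[OF X Y h a b(1) le]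
      Comp_mono_right[OF X X Y _ _ h endo_power_le_lub[OF X a s]]
    by (rule hom_le_trans) simp_all
  then show ?thesis
    using Comp_chain_sup_right[OF X Y Y endo_power_ascending_chain[OF Y b] t h]
    by (auto simp: carrier_hom intro: is_lub_le)
qed

end

section \<open>The saturation operator on the Kleisli category\<close>

theorem theorem5p7:
  fixes C :: "('o, 'm) category"
    and T :: "('o, 'm) monad"
    and P :: "'o \<Rightarrow> 'o \<Rightarrow> 'm gorder"
  assumes "monad C T"
    and "omega_cpo_enriched (kleisli C T) P"
    and "\<And>X Y. \<lbrakk>X \<in> Obj C; Y \<in> Obj C\<rbrakk> \<Longrightarrow> has_finite_joins (P X Y)"
    and "\<And>X Y f \<alpha> \<beta>.
      \<lbrakk>X \<in> Obj C; Y \<in> Obj C; f \<in> Hom C X Y;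
       \<alpha> \<in> Hom (kleisli C T) X X; \<beta> \<in> Hom (kleisli C T) Y Y;
       Comp (kleisli C T) X X Y (sharp C T X Y f) \<alpha>
         \<sqsubseteq>\<^bsub>P X Y\<^esub> Comp (kleisli C T) X Y Y \<beta> (sharp C T X Y f)\<rbrakk>
      \<Longrightarrow> Comp (kleisli C T) X X Y (sharp C T X Y f) (\<alpha> \<squnion>\<^bsub>P X X\<^esub> Id (kleisli C T) X)
         \<sqsubseteq>\<^bsub>P X Y\<^esub> Comp (kleisli C T) X Y Y (\<beta> \<squnion>\<^bsub>P Y Y\<^esub> Id (kleisli C T) Y) (sharp C T X Y f)"
    and "\<And>X Y f \<alpha> \<beta>.
      \<lbrakk>X \<in> Obj C; Y \<in> Obj C; f \<in> Hom C X Y;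
       \<alpha> \<in> Hom (kleisli C T) X X; \<beta> \<in> Hom (kleisli C T) Y Y;
       Comp (kleisli C T) X Y Y \<beta> (sharp C T X Y f)
         \<sqsubseteq>\<^bsub>P X Y\<^esub> Comp (kleisli C T) X X Y (sharp C T X Y f) \<alpha>\<rbrakk>
      \<Longrightarrow> Comp (kleisli C T) X Y Y (\<beta> \<squnion>\<^bsub>P Y Y\<^esub> Id (kleisli C T) Y) (sharp C T X Y f)
         \<sqsubseteq>\<^bsub>P X Y\<^esub> Comp (kleisli C T) X X Y (sharp C T X Y f) (\<alpha> \<squnion>\<^bsub>P X X\<^esub> Id (kleisli C T) X)"
  shows "\<exists>star. ordered_saturation_monad C T P star \<and>
    (\<forall>X\<in>Obj C. \<forall>\<alpha>\<in>Hom (kleisli C T) X X.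
      is_lub (P X X) (star X \<alpha>)
        (range (endo_power (kleisli C T) X (Id (kleisli C T) X \<squnion>\<^bsub>P X X\<^esub> \<alpha>))))"
proof -
  interpret monad C T by fact
  interpret K: omega_cpo_enriched "kleisli C T" P by fact
  let ?K = "kleisli C T"
  have obj [simp]: "Obj ?K = Obj C"
    by (simp add: kleisli_def)
  define e where "e X \<alpha> = Id ?K X \<squnion>\<^bsub>P X X\<^esub> \<alpha>" for X \<alpha>
  have e_lub: "is_lub (P X X) (e X \<alpha>) {Id ?K X, \<alpha>}"
    if "X \<in> Obj C" "\<alpha> \<in> Hom ?K X X" for X \<alpha>
    unfolding e_def using that assms(3)
    by (intro has_finite_joins_is_lub_join) (simp_all add: K.carrier_hom K.Id_in_Hom)
  have eH: "e X \<alpha> \<in> Hom ?K X X" if "X \<in> Obj C" "\<alpha> \<in> Hom ?K X X" for X \<alpha>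
    using is_lub_carrier[OF e_lub[OF that]] that by (simp add: K.carrier_hom)
  have Id_e: "Id ?K X \<sqsubseteq>\<^bsub>P X X\<^esub> e X \<alpha>" and le_e: "\<alpha> \<sqsubseteq>\<^bsub>P X X\<^esub> e X \<alpha>"
    if "X \<in> Obj C" "\<alpha> \<in> Hom ?K X X" for X \<alpha>
    using that by (auto intro!: is_lub_upper[OF e_lub[OF that]] simp: K.carrier_hom K.Id_in_Hom)
  \<comment> \<open>Antisymmetry makes the supremum unique, so on endomorphisms \<open>SOME\<close>
    merely names it.\<close>
  define star where "star X \<alpha> = (SOME s. is_lub (P X X) s (range (endo_power ?K X (e X \<alpha>))))"
    for X \<alpha>
  have star: "is_lub (P X X) (star X \<alpha>) (range (endo_power ?K X (e X \<alpha>)))"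
    if "X \<in> Obj C" "\<alpha> \<in> Hom ?K X X" for X \<alpha>
    unfolding star_def using that
    by (intro someI_ex[OF K.chain_sup_exists] K.endo_power_ascending_chain)
      (simp_all add: eH Id_e)
  have starH: "star X \<alpha> \<in> Hom ?K X X" if "X \<in> Obj C" "\<alpha> \<in> Hom ?K X X" for X \<alpha>
    using K.endo_power_lub_in_Hom[OF _ star[OF that]] that by simp
  have sharp: "sharp C T X Y f \<in> Hom ?K X Y"
    if "X \<in> Obj C" "Y \<in> Obj C" "f \<in> Hom C X Y" for X Y f
    using that by (simp add: sharp_def kleisli_def Comp_in_Hom ob_in_Obj unit_in_Hom)
  \<comment> \<open>The interpretations supply the monad and the order enrichment; cases 1 to 7 are
    the assumptions on \<open>star\<close>, in their order.\<close>
  have "ordered_saturation_monad C T P star"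
  proof (unfold_locales, goal_cases)
    case (1 X \<alpha>)
    then show ?case
      by (rule starH)
  next
    case (2 X \<alpha>)
    then show ?case
      \<comment> \<open>The power with exponent 0 is 1.\<close>
      using K.endo_power_le_lub[OF _ eH star, where n = 0] by simp
  next
    case (3 X \<alpha>)
    have "e X \<alpha> \<sqsubseteq>\<^bsub>P X X\<^esub> star X \<alpha>"
      \<comment> \<open>The power with exponent 1 unfolds to e . 1, hence to e, which lies above
        \<alpha>.\<close>
      using K.endo_power_le_lub[OF _ eH star, where n = 1] 3 by (simp add: K.Comp_Id_right eH)
    with le_e[OF 3] show ?case
      by (rule K.hom_le_trans) (use 3 eH starH in simp_all)
  next
    case (4 X \<alpha>)
    then show ?case
      using K.endo_power_lub_idem[OF _ eH Id_e star] by simp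
  next
    case (5 X \<alpha> \<beta>)
    \<comment> \<open>A bound of both 1 and \<alpha> bounds their join, hence all its powers and
      their supremum.\<close>
    then have "e X \<alpha> \<sqsubseteq>\<^bsub>P X X\<^esub> \<beta>"
      by (intro is_lub_le[OF e_lub]) (auto simp: K.carrier_hom)
    then have "endo_power ?K X (e X \<alpha>) n \<sqsubseteq>\<^bsub>P X X\<^esub> \<beta>" for n
      using 5 by (intro K.endo_power_le) (simp_all add: eH)
    then show ?case
      using 5 by (intro is_lub_le[OF star]) (auto simp: K.carrier_hom)
  next
    case (6 X Y f \<alpha> \<beta>)
    then show ?case
      \<comment> \<open>The hypothesis on joins carries the inequality from \<alpha> and \<beta> to
        \<open>e X \<alpha>\<close> and \<open>e Y \<beta>\<close>, whose powers have the two stars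
        as suprema.\<close>
      using assms(4)[OF 6]
      by (intro K.endo_power_lub_lax[OF _ _ sharp eH Id_e eH star star])
        (simp_all add: e_def join_comm[of _ "Id ?K _"])
  next
    case (7 X Y f \<alpha> \<beta>)
    then show ?case
      using assms(5)[OF 7]
      by (intro K.endo_power_lub_oplax[OF _ _ sharp eH eH Id_e star star])
        (simp_all add: e_def join_comm[of _ "Id ?K _"])
  qed
  with star show ?thesis
    unfolding e_def by blast
qed

end
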